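(* Let $H$ be a weakly-reducible bipartite graph. Then for all sufficiently large $n$, $\mathrm{nim}_2(n;H)=\mathrm{ex}(n,H)$. Furthermore, every 2-edge-colouring of $K_n$ attaining $\mathrm{nim}_2(n;H)$ has one of its colour classes isomorphic to a maximum $H$-free graph of order $n$.
   Context: For a 2-edge-colouring of $K_n$, an edge is a NIM-edge if it is not contained in any copy of $H$ all of whose edges have the same colour; $\mathrm{nim}_2(n;H)$ is the maximum number of NIM-edges over all 2-edge-colourings of $K_n$. $\mathrm{ex}(n,H)$ is the maximum number of edges in an $H$-free graph on $n$ vertices. An $h$-vertex graph $H$ is weakly-reducible if there exist $n_0$ and a vertex $v\in V(H)$ such that $\mathrm{ex}(n,H-v)<\mathrm{ex}(n,H)-2^{2h^2}n$ for all $n\ge n_0$. *)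

theory Defs
  imports Complex_Main "HOL-Library.Ramsey" "HOL-Library.FuncSet"
begin

type_synonym 'a graph = "'a set \<times> 'a set set"

abbreviation verts :: "'a graph \<Rightarrow> 'a set" where
  "verts \<equiv> fst"

abbreviation edges :: "'a graph \<Rightarrow> 'a set set" where
  "edges \<equiv> snd"

definition simple_graph :: "'a graph \<Rightarrow> bool" where
  "simple_graph G \<longleftrightarrow> finite (verts G) \<and> edges G \<subseteq> nsets (verts G) 2"

definition complete_graph :: "nat \<Rightarrow> nat graph" where
  "complete_graph n = ({..<n}, nsets {..<n} 2)"

definition bipartite :: "'a graph \<Rightarrow> bool" where
  "bipartite G \<longleftrightarrow> (\<exists>A B. A \<union> B = verts G \<and> A \<inter> B = {} \<and>
     (\<forall>e \<in> edges G. \<exists>a \<in> A. \<exists>b \<in> B. e = {a, b}))"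

definition delete_vertex :: "'a graph \<Rightarrow> 'a \<Rightarrow> 'a graph" where
  "delete_vertex G v = (verts G - {v}, {e \<in> edges G. v \<notin> e})"

definition isomorphic :: "'a graph \<Rightarrow> 'b graph \<Rightarrow> bool" where
  "isomorphic G G' \<longleftrightarrow>
     (\<exists>f. bij_betw f (verts G) (verts G') \<and> edges G' = (\<lambda>e. f ` e) ` edges G)"

definition subgraph :: "'a graph \<Rightarrow> 'a graph \<Rightarrow> bool" where
  "subgraph F G \<longleftrightarrow> simple_graph F \<and> verts F \<subseteq> verts G \<and> edges F \<subseteq> edges G"

text \<open>Copies are not required to be induced, and the isolated vertices of \<open>H\<close> belong to them.\<close>

definition copy_in :: "'a graph \<Rightarrow> 'b graph \<Rightarrow> 'b graph \<Rightarrow> bool" where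
  "copy_in H G F \<longleftrightarrow> subgraph F G \<and> isomorphic H F"

definition free_of :: "'a graph \<Rightarrow> 'b graph \<Rightarrow> bool" where
  "free_of H G \<longleftrightarrow> (\<nexists>F. copy_in H G F)"

definition free_graphs :: "nat \<Rightarrow> 'a graph \<Rightarrow> nat graph set" where
  "free_graphs n H = {G. simple_graph G \<and> card (verts G) = n \<and> free_of H G}"

text \<open>
  If \<open>H\<close> has no edges and \<open>n\<close> is at least its order, then there is no \<open>H\<close>-free graph of
  order \<open>n\<close>, and the supremum is \<open>0\<close>. In all other cases it is a maximum, because the
  family is nonempty and the number of edges is at most \<open>n choose 2\<close>.
\<close>

definition ex_num :: "nat \<Rightarrow> 'a graph \<Rightarrow> nat" where
  "ex_num n H = (SUP G \<in> free_graphs n H. card (edges G))"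

definition maximum_free_graph :: "nat \<Rightarrow> 'a graph \<Rightarrow> nat graph \<Rightarrow> bool" where
  "maximum_free_graph n H G \<longleftrightarrow> G \<in> free_graphs n H \<and> card (edges G) = ex_num n H"

text \<open>The values of a colouring outside the edge set of the complete graph are irrelevant.\<close>

definition edge_colouring :: "nat \<Rightarrow> nat \<Rightarrow> (nat set \<Rightarrow> nat) \<Rightarrow> bool" where
  "edge_colouring k n c \<longleftrightarrow> c \<in> edges (complete_graph n) \<rightarrow> {..<k}"

definition colour_class :: "nat \<Rightarrow> (nat set \<Rightarrow> nat) \<Rightarrow> nat \<Rightarrow> nat graph" where
  "colour_class n c i = (verts (complete_graph n), {e \<in> edges (complete_graph n). c e = i})"

definition monochromatic :: "('a set \<Rightarrow> nat) \<Rightarrow> 'a graph \<Rightarrow> bool" where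
  "monochromatic c F \<longleftrightarrow> (\<exists>i. \<forall>e \<in> edges F. c e = i)"

definition nim_edges :: "nat \<Rightarrow> 'a graph \<Rightarrow> (nat set \<Rightarrow> nat) \<Rightarrow> nat set set" where
  "nim_edges n H c = {e \<in> edges (complete_graph n).
     \<nexists>F. copy_in H (complete_graph n) F \<and> monochromatic c F \<and> e \<in> edges F}"

definition nim :: "nat \<Rightarrow> nat \<Rightarrow> 'a graph \<Rightarrow> nat" where
  "nim k n H = Max {card (nim_edges n H c) | c. edge_colouring k n c}"

text \<open>The inequality is stated over the reals, so that the subtraction is not truncated.\<close>

definition weakly_reducible :: "'a graph \<Rightarrow> bool" where
  "weakly_reducible H \<longleftrightarrow> (\<exists>n\<^sub>0. \<exists>v \<in> verts H. \<forall>n \<ge> n\<^sub>0.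
     real (ex_num n (delete_vertex H v))
       < real (ex_num n H) - 2 ^ (2 * card (verts H) ^ 2) * real n)"

end

theory Submission
  imports Defs
begin

text \<open>
  By pigeonhole, any two large vertex sets contain a monochromatic \<open>K\<^bsub>h,h\<^esub>\<close> between them, and if
  \<open>x\<close> is joined to one side of it, \<open>y\<close> to the other side, and \<open>xy\<close> is an edge, all in the colour of
  the \<open>K\<^bsub>h,h\<^esub>\<close>, then \<open>xy\<close> lies in a monochromatic copy of the bipartite graph \<open>H\<close>. Applied to a
  red and a blue NIM-neighbourhood this bounds all NIM-degrees in one of the colours, say blue.
  If \<open>zw\<close> is a blue NIM-edge, the same argument shows that for some \<open>p \<in> {z, w}\<close> every vertex has
  boundedly many red NIM-neighbours outside the red neighbourhood of \<open>p\<close>. The red NIM-edges inside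
  this neighbourhood contain no copy of \<open>H - r\<close>, so there are at most \<open>ex(n, H - r) + O(n)\<close>
  NIM-edges, which is less than \<open>ex(n, H)\<close> if \<open>r\<close> witnesses weak reducibility. Hence all NIM-edges
  of an extremal colouring have the same colour.
\<close>

section \<open>Embeddings and the extremal number\<close>

text \<open>Copies are handled as injective maps because these can be glued, composed and counted
  directly. Edges are only required to map to edges, as copies need not be induced.\<close>

definition embedding :: "'a graph \<Rightarrow> 'b graph \<Rightarrow> ('a \<Rightarrow> 'b) \<Rightarrow> bool" where
  "embedding H G f \<longleftrightarrow> inj_on f (verts H) \<and> f ` verts H \<subseteq> verts G \<and> (\<forall>e \<in> edges H. f ` e \<in> edges G)"

lemma simple_graph_edge:
  assumes "simple_graph G" "e \<in> edges G"
  shows "e \<subseteq> verts G" "card e = 2" "finite e"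
  using assms by (auto simp: simple_graph_def nsets_def)

lemma finite_edges: "simple_graph G \<Longrightarrow> finite (edges G)"
  by (auto simp: simple_graph_def intro: finite_subset finite_imp_finite_nsets)

lemma copy_in_iff:
  assumes "simple_graph H"
  shows "copy_in H G F \<longleftrightarrow> (\<exists>f. embedding H G f \<and> F = (f ` verts H, (`) f ` edges H))"
proof
  assume "copy_in H G F"
  then obtain f where f: "subgraph F G" "bij_betw f (verts H) (verts F)" "edges F = (`) f ` edges H"
    by (auto simp: copy_in_def isomorphic_def)
  then have "embedding H G f" "F = (f ` verts H, (`) f ` edges H)"
    by (auto simp: embedding_def subgraph_def bij_betw_def prod_eq_iff)
  then show "\<exists>f. embedding H G f \<and> F = (f ` verts H, (`) f ` edges H)" by blast
next
  assume "\<exists>f. embedding H G f \<and> F = (f ` verts H, (`) f ` edges H)"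
  then obtain f where f: "embedding H G f" "F = (f ` verts H, (`) f ` edges H)" by blast
  have "simple_graph F"
    using assms f inj_on_subset[of f "verts H"]
    by (auto simp: simple_graph_def embedding_def nsets_def card_image image_subset_iff subset_iff)
  then show "copy_in H G F"
    using f by (auto simp: copy_in_def isomorphic_def subgraph_def embedding_def bij_betw_def)
qed

lemma free_of_iff:
  assumes "simple_graph H"
  shows "free_of H G \<longleftrightarrow> (\<nexists>f. embedding H G f)"
  unfolding free_of_def copy_in_iff[OF assms] by blast

lemma simple_delete_vertex: "simple_graph H \<Longrightarrow> simple_graph (delete_vertex H v)"
  by (auto simp: simple_graph_def delete_vertex_def nsets_def)

section \<open>Attainment of the extremal number\<close>

lemma card_edges_le:
  assumes "simple_graph G"
  shows "card (edges G) \<le> 2 ^ card (verts G)"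
proof -
  have "edges G \<subseteq> Pow (verts G)" "finite (verts G)"
    using assms by (auto simp: simple_graph_def nsets_def)
  then show ?thesis using card_mono[of "Pow (verts G)"] by (simp add: card_Pow)
qed

lemma bdd_above_free_graphs: "bdd_above ((\<lambda>G. card (edges G)) ` free_graphs n H)"
  unfolding bdd_above_def using card_edges_le by (auto simp: free_graphs_def intro!: exI[of _ "2 ^ n"])

lemma ex_num_upper: "G \<in> free_graphs n H \<Longrightarrow> card (edges G) \<le> ex_num n H"
  unfolding ex_num_def by (rule cSUP_upper[OF _ bdd_above_free_graphs])

lemma maximum_free_graph_exists:
  assumes "free_graphs n H \<noteq> {}"
  obtains G where "maximum_free_graph n H G"
proof -
  have "ex_num n H \<in> (\<lambda>G. card (edges G)) ` free_graphs n H"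
    using assms bdd_above_free_graphs[of n H] Max_in
    by (simp add: ex_num_def cSup_eq_Max bdd_above_nat)
  then show ?thesis using that by (auto simp: maximum_free_graph_def)
qed

text \<open>The supremum of the empty set of naturals is \<open>0\<close>, so a positive value rules
  out an empty family.\<close>

lemma ex_num_pos_maximum:
  assumes "ex_num n H > 0"
  obtains G where "maximum_free_graph n H G"
proof -
  have "free_graphs n H \<noteq> {}" using assms by (auto simp: ex_num_def Sup_nat_def)
  then show ?thesis using maximum_free_graph_exists that by blast
qed

text \<open>Any injection of the vertices is then an embedding, so the family is empty and the
  supremum takes its default value. This later shows that a graph with a large extremal number has
  an edge.\<close>

lemma ex_num_edgeless:
  assumes "simple_graph H" "edges H = {}" "card (verts H) \<le> n"
  shows "ex_num n H = 0"
proof -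
  have "\<exists>f. embedding H G f" if G: "simple_graph G" "card (verts G) = n" for G :: "nat graph"
  proof -
    have "finite (verts H)" "finite (verts G)" using assms G by (auto simp: simple_graph_def)
    then obtain f where "f ` verts H \<subseteq> verts G" "inj_on f (verts H)"
      using card_le_inj[of "verts H" "verts G"] assms(3) G(2) by auto
    then show ?thesis using assms by (auto simp: embedding_def)
  qed
  then have "free_graphs n H = {}" 
    using free_of_iff[OF assms(1)] unfolding free_graphs_def by blast
  then show ?thesis by (simp add: ex_num_def)
qed

section \<open>NIM-edges\<close>

lemma in_complete_graph [simp]:
  "verts (complete_graph n) = {..<n}" "edges (complete_graph n) = nsets {..<n} 2"
  by (auto simp: complete_graph_def)

lemma nim_edgeD: "{x, y} \<in> nim_edges n H c \<Longrightarrow> x < n \<and> y < n \<and> x \<noteq> y"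
  by (auto simp: nim_edges_def)

lemma finite_nim_edges: "finite (nim_edges n H c)"
  by (rule finite_subset[of _ "nsets {..<n} 2"])
    (auto simp: nim_edges_def intro: finite_imp_finite_nsets)

lemma nim_edge_not_in_copy:
  assumes "simple_graph H" "inj_on f (verts H)" "f ` verts H \<subseteq> {..<n}"
    and "\<And>d. d \<in> edges H \<Longrightarrow> c (f ` d) = i" "d \<in> edges H"
  shows "f ` d \<notin> nim_edges n H c"
proof -
  have "f ` e \<in> nsets {..<n} 2" if "e \<in> edges H" for e
    using simple_graph_edge[OF assms(1) that] assms(2,3) inj_on_subset[of f "verts H" e]
    by (auto simp: nsets_def card_image)
  then have "embedding H (complete_graph n) f" using assms by (auto simp: embedding_def)
  then have "copy_in H (complete_graph n) (f ` verts H, (`) f ` edges H)"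
    using copy_in_iff[OF assms(1)] by blast
  moreover have "monochromatic c (f ` verts H, (`) f ` edges H)"
    using assms by (auto simp: monochromatic_def)
  ultimately show ?thesis using assms(5) by (fastforce simp: nim_edges_def)
qed

text \<open>A copy of \<open>H\<close> through \<open>{x, y}\<close> arises by sending
  \<open>v\<close> to \<open>x\<close>, \<open>w\<close> to \<open>y\<close>, the rest of
  \<open>Y\<close> into \<open>P\<close> and the rest of \<open>X\<close> into \<open>Q\<close>.
  Neighbours of \<open>v\<close> lie in \<open>Y\<close>, which is why \<open>P\<close> has to be
  joined to \<open>x\<close>; likewise \<open>Q\<close> to \<open>y\<close>.\<close>

lemma not_nim_edgeI:
  assumes H: "simple_graph H" and XY: "X \<union> Y = verts H" "X \<inter> Y = {}"
    "\<And>e. e \<in> edges H \<Longrightarrow> \<exists>a\<in>X. \<exists>b\<in>Y. e = {a, b}"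
    and vw: "v \<in> X" "w \<in> Y" "{v, w} \<in> edges H"
    and PQ: "P \<subseteq> {..<n}" "Q \<subseteq> {..<n}" "P \<inter> Q = {}" "x \<notin> P \<union> Q" "y \<notin> P \<union> Q"
    and card: "card (Y - {w}) \<le> card P" "card (X - {v}) \<le> card Q"
    and c: "c {x, y} = i" "\<And>p. p \<in> P \<Longrightarrow> c {x, p} = i" "\<And>q. q \<in> Q \<Longrightarrow> c {y, q} = i"
    "\<And>p q. p \<in> P \<Longrightarrow> q \<in> Q \<Longrightarrow> c {p, q} = i"
  shows "{x, y} \<notin> nim_edges n H c"
proof
  assume nim: "{x, y} \<in> nim_edges n H c"
  then have xy: "x < n" "y < n" "x \<noteq> y" using nim_edgeD by blast+
  have "finite (X \<union> Y)" using H XY(1) by (simp add: simple_graph_def)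
  then have fin: "finite X" "finite Y" by auto
  have "finite P" "finite Q" using PQ finite_subset by blast+
  obtain g where g: "g ` (Y - {w}) \<subseteq> P" "inj_on g (Y - {w})"
    using card_le_inj[of "Y - {w}" P] card(1) fin \<open>finite P\<close> by auto
  obtain k where k: "k ` (X - {v}) \<subseteq> Q" "inj_on k (X - {v})"
    using card_le_inj[of "X - {v}" Q] card(2) fin \<open>finite Q\<close> by auto
  define f where "f = (\<lambda>u. if u = v then x else if u = w then y else if u \<in> Y then g u else k u)"
  have vw': "v \<noteq> w" using vw XY by auto
  have fY: "f u \<in> P" if "u \<in> Y" "u \<noteq> w" for u
    using that g(1) vw XY(2) by (auto simp: f_def)
  have fX: "f u \<in> Q" if "u \<in> X" "u \<noteq> v" for u
    using that k(1) vw XY(2) by (auto simp: f_def)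
  have fvw: "f v = x" "f w = y" using vw' by (auto simp: f_def)
  have injX: "inj_on f (X - {v})"
    by (rule inj_on_cong[THEN iffD1, OF _ k(2)]) (use vw XY(2) in \<open>auto simp: f_def\<close>)
  have injY: "inj_on f (Y - {w})"
    by (rule inj_on_cong[THEN iffD1, OF _ g(2)]) (use vw XY(2) in \<open>auto simp: f_def\<close>)
  have img: "f ` (X - {v}) \<subseteq> Q" "f ` (Y - {w}) \<subseteq> P" using fX fY by auto
  then have "f ` (X - {v}) \<inter> f ` (Y - {w}) = {}" using PQ(3) by blast
  then have "inj_on f ((X - {v}) \<union> (Y - {w}))"
    using injX injY by (auto simp: inj_on_Un)
  moreover have "y \<notin> f ` ((X - {v}) \<union> (Y - {w}))" "x \<notin> f ` ((X - {v}) \<union> (Y - {w}))"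
    using img PQ(4,5) by blast+
  ultimately have "inj_on f (insert v (insert w ((X - {v}) \<union> (Y - {w}))))"
    using fvw xy vw' by (auto simp: inj_on_insert)
  moreover have "insert v (insert w ((X - {v}) \<union> (Y - {w}))) = verts H"
    using vw XY(1) by auto
  ultimately have inj: "inj_on f (verts H)" by simp
  have sub: "f ` verts H \<subseteq> {..<n}"
  proof
    fix z assume "z \<in> f ` verts H"
    then obtain u where "z = f u" "u \<in> X \<union> Y" using XY(1) by auto
    then show "z \<in> {..<n}" using fX[of u] fY[of u] fvw xy PQ(1,2)
      by (cases "u = v"; cases "u = w") auto
  qed
  have "c (f ` d) = i" if d: "d \<in> edges H" for d
  proof -
    obtain a b where "a \<in> X" "b \<in> Y" "d = {a, b}" using XY(3)[OF d] by auto
    have "c {f a, f b} = i"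
    proof (cases "a = v")
      case True
      then show ?thesis using fY[OF \<open>b \<in> Y\<close>] fvw c(1,2) by (cases "b = w") auto
    next
      case False
      then have "f a \<in> Q" using fX \<open>a \<in> X\<close> by blast
      then have "c {f b, f a} = i"
        using fY[OF \<open>b \<in> Y\<close>] fvw c(3,4) by (cases "b = w") auto
      then show ?thesis by (simp add: insert_commute)
    qed
    then show ?thesis using \<open>d = {a, b}\<close> by simp
  qed
  then have "f ` {v, w} \<notin> nim_edges n H c"
    using nim_edge_not_in_copy[of H f n c i "{v, w}"] H inj sub vw(3) by blast
  then show False using nim fvw by simp
qed

section \<open>Monochromatic bipartite graphs between large sets\<close>

text \<open>The summand \<open>2 * h + 3\<close> pays for at most three forbidden vertices and for
  \<open>2 * h\<close> vertices chosen on the first side. The main term is for a pigeonhole over the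
  \<open>2 ^ (2 * h)\<close> subsets of the chosen vertices.\<close>

definition bip_ramsey_bound :: "nat \<Rightarrow> nat" where
  "bip_ramsey_bound h = h * 2 ^ (2 * h) + 2 * h + 3"

text \<open>Fix \<open>2 * h\<close> vertices of \<open>A\<close> and sort the vertices of
  \<open>D\<close> by the set \<open>S\<close> of chosen vertices that they see in colour 0. Some
  class has \<open>h\<close> members, and \<open>S\<close> or its complement has at least
  \<open>h\<close> elements. The sets \<open>A\<close> and \<open>D\<close> may overlap;
  \<open>F\<close> holds the vertices to be avoided in the applications.\<close>

lemma monochromatic_bipartite:
  assumes "bip_ramsey_bound h \<le> card A" "bip_ramsey_bound h \<le> card D" "finite A" "finite D"
    and F: "finite F" "card F \<le> 3"
    and c: "\<And>a d. a \<in> A \<Longrightarrow> d \<in> D \<Longrightarrow> a \<noteq> d \<Longrightarrow> c {a, d} < (2::nat)"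
  obtains P Q i where "P \<subseteq> A - F" "Q \<subseteq> D - F" "P \<inter> Q = {}" "h \<le> card P" "h \<le> card Q" "i < 2"
    "\<And>p q. p \<in> P \<Longrightarrow> q \<in> Q \<Longrightarrow> c {p, q} = i"
proof -
  have "2 * h \<le> card (A - F)"
    using assms(1) diff_card_le_card_Diff[of F A] F unfolding bip_ramsey_bound_def by linarith
  then obtain A' where A': "A' \<subseteq> A - F" "card A' = 2 * h" "finite A'"
    using obtain_subset_with_card_n by metis
  define D' where "D' = D - (F \<union> A')"
  have "card (F \<union> A') \<le> 2 * h + 3" using card_Un_le[of F A'] A' F by linarith
  then have D': "h * 2 ^ (2 * h) \<le> card D'" "finite D'"
    using assms(2,4) diff_card_le_card_Diff[of "F \<union> A'" D] F A'
    unfolding bip_ramsey_bound_def D'_def by (auto simp: algebra_simps)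
  define g where "g = (\<lambda>d. {a \<in> A'. c {a, d} = 0})"
  have "\<exists>S \<in> Pow A'. h \<le> card (g -` {S} \<inter> D')"
  proof (rule ccontr)
    assume "\<not> ?thesis"
    then have less: "\<And>S. S \<in> Pow A' \<Longrightarrow> card (g -` {S} \<inter> D') < h" by (auto simp: not_le)
    have "D' = (\<Union>S\<in>Pow A'. g -` {S} \<inter> D')" by (auto simp: g_def)
    then have "card D' \<le> (\<Sum>S\<in>Pow A'. card (g -` {S} \<inter> D'))"
      using card_UN_le[of "Pow A'" "\<lambda>S. g -` {S} \<inter> D'"] A'(3) by simp
    \<comment> \<open>Strictness holds because the sum has at least one term, that of the empty
      set.\<close>
    also have "\<dots> < (\<Sum>S\<in>Pow A'. h)"
      using less A'(3) by (intro sum_strict_mono) auto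
    also have "\<dots> = h * 2 ^ (2 * h)" using A' by (simp add: card_Pow)
    finally show False using D' by simp
  qed
  then obtain S where S: "S \<subseteq> A'" "h \<le> card (g -` {S} \<inter> D')" by auto
  define Q where "Q = g -` {S} \<inter> D'"
  have Q: "Q \<subseteq> D - F" "A' \<inter> Q = {}" "h \<le> card Q" using S by (auto simp: Q_def D'_def)
  have "card S + card (A' - S) = 2 * h"
    using A' S by (metis card_Diff_subset card_mono finite_subset le_add_diff_inverse)
  then consider "h \<le> card S" | "h \<le> card (A' - S)" by linarith
  then show ?thesis
  proof cases
    case 1
    show ?thesis
      by (rule that[of S Q 0]) (use 1 S A' Q in \<open>auto simp: Q_def g_def\<close>)
  next
    case 2
    have "c {p, q} = 1" if "p \<in> A' - S" "q \<in> Q" for p q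
    proof -
      have "c {p, q} < 2" "c {p, q} \<noteq> 0" using that A' Q c[of p q] by (auto simp: Q_def g_def)
      then show ?thesis by simp
    qed
    then show ?thesis
      by (intro that[of "A' - S" Q 1]) (use 2 A' Q in auto)
  qed
qed

section \<open>Two colours of NIM-edges\<close>

definition nim_nbrs :: "nat \<Rightarrow> 'a graph \<Rightarrow> (nat set \<Rightarrow> nat) \<Rightarrow> nat \<Rightarrow> nat \<Rightarrow> nat set" where
  "nim_nbrs n H c i x = {u. {x, u} \<in> nim_edges n H c \<and> c {x, u} = i}"

definition colour_nbrs :: "nat \<Rightarrow> (nat set \<Rightarrow> nat) \<Rightarrow> nat \<Rightarrow> nat \<Rightarrow> nat set" where
  "colour_nbrs n c i x = {u \<in> {..<n}. u \<noteq> x \<and> c {x, u} = i}"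

lemma nim_nbrs_subset: "nim_nbrs n H c i x \<subseteq> colour_nbrs n c i x"
  using nim_edgeD by (fastforce simp: nim_nbrs_def colour_nbrs_def)

lemma finite_colour_nbrs: "finite (colour_nbrs n c i x)"
  by (simp add: colour_nbrs_def)

lemma finite_nim_nbrs: "finite (nim_nbrs n H c i x)"
  using nim_nbrs_subset finite_colour_nbrs by (rule finite_subset)

text \<open>An edge not inside \<open>S\<close> has an endpoint \<open>u\<close> outside
  \<open>S\<close>; it is counted at its other endpoint.\<close>

lemma card_nim_edges_le:
  assumes "\<And>x. x < n \<Longrightarrow> card (nim_nbrs n H c i x - S) \<le> k"
  shows "card {e \<in> nim_edges n H c. c e = i \<and> \<not> e \<subseteq> S} \<le> n * k"
proof -
  have "{e \<in> nim_edges n H c. c e = i \<and> \<not> e \<subseteq> S}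
      \<subseteq> (\<Union>x<n. (\<lambda>u. {x, u}) ` (nim_nbrs n H c i x - S))" (is "?E \<subseteq> _")
  proof
    fix e assume e: "e \<in> ?E"
    then have "e \<in> nsets {..<n} 2" by (simp add: nim_edges_def)
    then obtain x u where xu: "e = {x, u}" "x < n" "u < n" "u \<notin> S"
      using e by (auto elim!: nsets2_E simp: insert_commute)
    then have "u \<in> nim_nbrs n H c i x - S" using e by (auto simp: nim_nbrs_def)
    then show "e \<in> (\<Union>x<n. (\<lambda>u. {x, u}) ` (nim_nbrs n H c i x - S))" using xu by auto
  qed
  then have "card ?E \<le> card (\<Union>x<n. (\<lambda>u. {x, u}) ` (nim_nbrs n H c i x - S))"
    by (rule card_mono[rotated]) (auto simp: finite_nim_nbrs)
  also have "\<dots> \<le> (\<Sum>x<n. card ((\<lambda>u. {x, u}) ` (nim_nbrs n H c i x - S)))"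
    by (rule card_UN_le) simp
  also have "\<dots> \<le> (\<Sum>x<n. k)"
    using assms by (intro sum_mono) (auto intro: order_trans[OF card_image_le] simp: finite_nim_nbrs)
  finally show ?thesis by simp
qed

lemma card_nim_edges_colour_le:
  assumes "\<And>x. x < n \<Longrightarrow> card (nim_nbrs n H c i x) \<le> k"
  shows "card {e \<in> nim_edges n H c. c e = i} \<le> n * k"
proof -
  \<comment> \<open>An edge has two elements, so none lies inside the empty set.\<close>
  have "{e \<in> nim_edges n H c. c e = i \<and> \<not> e \<subseteq> {}} = {e \<in> nim_edges n H c. c e = i}"
    by (auto simp: nim_edges_def nsets_def)
  then show ?thesis using card_nim_edges_le[of n H c i "{}" k] assms by simp
qed

lemma card_nim_edges_split:
  assumes "edge_colouring 2 n c" "i < 2" "j < 2" "i \<noteq> j"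
  shows "card (nim_edges n H c)
    = card {e \<in> nim_edges n H c. c e = i} + card {e \<in> nim_edges n H c. c e = j}"
proof -
  have "c e < 2" if "e \<in> nim_edges n H c" for e
    using assms(1) that by (auto simp: edge_colouring_def nim_edges_def)
  then have "nim_edges n H c
      = {e \<in> nim_edges n H c. c e = i} \<union> {e \<in> nim_edges n H c. c e = j}"
    using assms(2-4) by force
  also have "card \<dots> = card {e \<in> nim_edges n H c. c e = i} + card {e \<in> nim_edges n H c. c e = j}"
    using assms(4) finite_nim_edges[of n H c] by (intro card_Un_disjoint) auto
  finally show ?thesis .
qed

text \<open>A copy of \<open>H - r\<close> among the NIM-edges inside the neighbourhood of \<open>p\<close> in their own colour
  extends to a copy of \<open>H\<close> by sending \<open>r\<close> to \<open>p\<close>. The isolated vertices of \<open>H - r\<close> may lie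
  outside that neighbourhood and have to be moved into it, as they can be adjacent to \<open>r\<close>.\<close>

lemma card_nim_edges_inside_le:
  assumes H: "simple_graph H" and r: "r \<in> verts H" and e: "e \<in> edges H" "r \<notin> e"
    and p: "p < n" and S: "S = colour_nbrs n c i p" and card_S: "card (verts H) \<le> card S"
  shows "card {e \<in> nim_edges n H c. c e = i \<and> e \<subseteq> S} \<le> ex_num n (delete_vertex H r)"
proof -
  define N where "N = {e \<in> nim_edges n H c. c e = i \<and> e \<subseteq> S}"
  define H' where "H' = delete_vertex H r"
  have H': "simple_graph H'" unfolding H'_def using H by (rule simple_delete_vertex)
  have finS: "finite S" using S finite_colour_nbrs by blast
  have finH: "finite (verts H)" using H by (simp add: simple_graph_def)
  have "\<nexists>f. embedding H' ({..<n}, N) f"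
  proof
    assume "\<exists>f. embedding H' ({..<n}, N) f"
    then obtain f where f: "inj_on f (verts H - {r})" "\<And>d. d \<in> edges H \<Longrightarrow> r \<notin> d \<Longrightarrow> f ` d \<in> N"
      by (auto simp: embedding_def H'_def delete_vertex_def)
    \<comment> \<open>The non-isolated vertices of \<open>H - r\<close>: their images are endpoints
      of edges in \<open>N\<close> and so lie in \<open>S\<close> already. Only the remaining
      vertices \<open>I\<close> are placed anew.\<close>
    define J where "J = \<Union>(edges H')"
    have J: "J \<subseteq> verts H - {r}"
      using simple_graph_edge(1)[OF H'] by (fastforce simp: J_def H'_def delete_vertex_def)
    have fJ: "f ` J \<subseteq> S"
      using f(2) by (fastforce simp: J_def H'_def delete_vertex_def N_def)
    have injJ: "inj_on f J" using f(1) J by (rule inj_on_subset)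
    have finJ: "finite J" using J finH by (meson finite_Diff finite_subset)
    define I where "I = verts H - {r} - J"
    have "card I = card (verts H) - 1 - card J"
      using J r finH finJ by (simp add: I_def card_Diff_subset)
    moreover have "card (S - f ` J) = card S - card J"
      using fJ finJ injJ by (simp add: card_Diff_subset card_image)
    ultimately have "card I \<le> card (S - f ` J)" using card_S by linarith
    then obtain g where g: "g ` I \<subseteq> S - f ` J" "inj_on g I"
      using card_le_inj[of I "S - f ` J"] finS finH by (auto simp: I_def)
    define \<phi> where "\<phi> = (\<lambda>u. if u = r then p else if u \<in> J then f u else g u)"
    have pS: "p \<notin> S" using S by (simp add: colour_nbrs_def)
    have \<phi>S: "\<phi> u \<in> S" if "u \<in> verts H" "u \<noteq> r" for u
      using that fJ g(1) by (auto simp: \<phi>_def I_def)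
    have "inj_on \<phi> J" "inj_on \<phi> I"
      using injJ g(2) J by (auto simp: \<phi>_def I_def inj_on_def)
    moreover have "\<phi> ` J \<inter> \<phi> ` I = {}" using g(1) J by (auto simp: \<phi>_def I_def)
    ultimately have "inj_on \<phi> (J \<union> I)" unfolding inj_on_Un by blast
    moreover have "J \<union> I = verts H - {r}" using J by (auto simp: I_def)
    moreover have "\<phi> ` (verts H - {r}) \<subseteq> S" using \<phi>S by blast
    then have "\<phi> r \<notin> \<phi> ` (verts H - {r})" using pS by (auto simp: \<phi>_def)
    ultimately have inj: "inj_on \<phi> (verts H)"
      using inj_on_insert[of \<phi> r "verts H - {r}"] r by (simp add: insert_absorb)
    have "S \<subseteq> {..<n}" using S by (auto simp: colour_nbrs_def)
    then have sub: "\<phi> ` verts H \<subseteq> {..<n}"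
      using \<phi>S p by (force simp: \<phi>_def)
    have \<phi>d: "\<phi> ` d = f ` d" if "d \<in> edges H" "r \<notin> d" for d
      using that by (intro image_cong) (auto simp: \<phi>_def J_def H'_def delete_vertex_def)
    have "c (\<phi> ` d) = i" if d: "d \<in> edges H" for d
    proof (cases "r \<in> d")
      case True
      then obtain u where u: "d = {r, u}" "u \<noteq> r"
        using simple_graph_edge(2)[OF H d] by (auto simp: card_2_iff)
      then have "\<phi> u \<in> S" using \<phi>S simple_graph_edge(1)[OF H d] by auto
      then have "c {p, \<phi> u} = i" using S by (simp add: colour_nbrs_def)
      moreover have "\<phi> r = p" by (simp add: \<phi>_def)
      ultimately show ?thesis using u by simp
    next
      case False
      then show ?thesis using \<phi>d[OF d] f(2)[OF d] by (simp add: N_def)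
    qed
    then have "\<phi> ` e \<notin> nim_edges n H c"
      using nim_edge_not_in_copy[of H \<phi> n c i e] H inj sub e(1) by blast
    then show False using \<phi>d[OF e] f(2)[OF e] by (simp add: N_def)
  qed
  then have "({..<n}, N) \<in> free_graphs n H'"
    using free_of_iff[OF H'] by (auto simp: free_graphs_def simple_graph_def N_def nim_edges_def)
  then show ?thesis using ex_num_upper by (fastforce simp: H'_def N_def)
qed

text \<open>Fixes a bipartition of \<open>H\<close> together with an edge \<open>{v, w}\<close>,
  which is the edge mapped onto a supposed NIM-edge in each contradiction below.\<close>

locale nim_colouring =
  fixes H :: "'a graph" and n :: nat and c :: "nat set \<Rightarrow> nat" and X Y :: "'a set" and v w :: 'a
  assumes simple: "simple_graph H" and parts: "X \<union> Y = verts H" "X \<inter> Y = {}"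
    and edge_parts: "\<And>e. e \<in> edges H \<Longrightarrow> \<exists>a\<in>X. \<exists>b\<in>Y. e = {a, b}"
    and vw: "v \<in> X" "w \<in> Y" "{v, w} \<in> edges H"
    and colouring: "edge_colouring 2 n c"
begin

abbreviation "h \<equiv> card (verts H)"

lemma colour_less: "x < n \<Longrightarrow> y < n \<Longrightarrow> x \<noteq> y \<Longrightarrow> c {x, y} < 2"
  using colouring by (auto simp: edge_colouring_def)

lemma h_ge_2: "h \<ge> 2"
  and card_parts: "card (Y - {w}) \<le> h - 2" "card (X - {v}) \<le> h - 2"
proof -
  have fin: "finite (verts H)" using simple by (simp add: simple_graph_def)
  have "v \<noteq> w" using parts vw by auto
  then have vw': "card {v, w} = 2" "{v, w} \<subseteq> verts H" using parts vw by auto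
  then show "h \<ge> 2" using card_mono[OF fin] by metis
  have eq: "card (verts H - {v, w}) = h - 2"
    using vw' by (simp add: card_Diff_subset)
  show "card (Y - {w}) \<le> h - 2" "card (X - {v}) \<le> h - 2"
    unfolding eq[symmetric] using fin parts vw by (intro card_mono; auto)+
qed

text \<open>Once \<open>v\<close> and \<open>w\<close> are placed, each part has at most
  \<open>h - 2\<close> further vertices. The resulting slack allows a vertex to be taken out of a
  set of size \<open>h\<close>.\<close>

lemma not_nim_edge:
  assumes "P \<subseteq> {..<n}" "Q \<subseteq> {..<n}" "P \<inter> Q = {}" "x \<notin> P \<union> Q" "y \<notin> P \<union> Q"
    and "h \<le> card P + 2" "h \<le> card Q + 2"
    and "c {x, y} = i" "\<And>p. p \<in> P \<Longrightarrow> c {x, p} = i" "\<And>q. q \<in> Q \<Longrightarrow> c {y, q} = i"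
    "\<And>p q. p \<in> P \<Longrightarrow> q \<in> Q \<Longrightarrow> c {p, q} = i"
  shows "{x, y} \<notin> nim_edges n H c"
  using assms card_parts
  by (intro not_nim_edgeI[OF simple parts edge_parts vw, of P n Q x y c i]) auto

text \<open>For any \<open>u\<close> in \<open>P\<close>, the NIM-edge \<open>{x, u}\<close> has
  colour \<open>i\<close>; \<open>x\<close> is joined to \<open>P - {u}\<close> and \<open>u\<close>
  to \<open>Q\<close> in the same colour, so \<open>not_nim_edge\<close> applies to it.\<close>

lemma no_monochromatic_pair:
  assumes P: "P \<subseteq> nim_nbrs n H c i x" "h \<le> card P"
    and Q: "Q \<subseteq> {..<n}" "h \<le> card Q" "P \<inter> Q = {}" "x \<notin> Q"
    and c: "\<And>p q. p \<in> P \<Longrightarrow> q \<in> Q \<Longrightarrow> c {p, q} = i"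
  shows False
proof -
  have P': "P \<subseteq> {..<n}" "x \<notin> P" "\<And>p. p \<in> P \<Longrightarrow> c {x, p} = i"
    using P(1) nim_nbrs_subset[of n H c i x] by (auto simp: colour_nbrs_def)
  obtain u where u: "u \<in> P" using P(2) h_ge_2 by fastforce
  have "h \<le> card (P - {u}) + 2" using P(2) u P'(1) finite_subset by (auto simp: card_Diff_singleton)
  then have "{x, u} \<notin> nim_edges n H c"
    using P' Q c u by (intro not_nim_edge[of "P - {u}" Q x u i]) auto
  then show False using u P(1) by (auto simp: nim_nbrs_def)
qed

text \<open>Otherwise some \<open>x\<close> has many NIM-neighbours in colour 0 and some
  \<open>z\<close> many in colour 1. The complete bipartite graph found between the two
  neighbourhoods has colour 0, which is impossible at \<open>x\<close>, or colour 1, which is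
  impossible at \<open>z\<close>.\<close>

lemma degree_dichotomy:
  "\<exists>j<2. \<forall>x. card (nim_nbrs n H c j x) < bip_ramsey_bound h"
proof (rule ccontr)
  assume no: "\<not> ?thesis"
  obtain x where x: "bip_ramsey_bound h \<le> card (nim_nbrs n H c 0 x)"
    using no zero_less_numeral not_less by metis
  obtain z where z: "bip_ramsey_bound h \<le> card (nim_nbrs n H c 1 z)"
    using no one_less_numeral_iff semiring_norm(76) not_less by metis
  have less: "c {a, d} < 2"
    if "a \<in> nim_nbrs n H c 0 x" "d \<in> nim_nbrs n H c 1 z" "a \<noteq> d" for a d
    using that nim_nbrs_subset by (intro colour_less) (fastforce simp: colour_nbrs_def)+
  obtain P Q i where PQ: "P \<subseteq> nim_nbrs n H c 0 x - {x, z}" "Q \<subseteq> nim_nbrs n H c 1 z - {x, z}"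
    "P \<inter> Q = {}" "h \<le> card P" "h \<le> card Q" "i < 2"
    and mono: "\<And>p q. p \<in> P \<Longrightarrow> q \<in> Q \<Longrightarrow> c {p, q} = i"
    by (rule monochromatic_bipartite[OF x z finite_nim_nbrs finite_nim_nbrs, of "{x, z}" c])
      (use less in \<open>auto simp: card_insert_if\<close>)
  have sub: "P \<subseteq> {..<n}" "Q \<subseteq> {..<n}"
    using PQ(1,2) nim_nbrs_subset by (fastforce simp: colour_nbrs_def)+
  consider "i = 0" | "i = 1" using PQ(6) by linarith
  then show False
  proof cases
    case 1
    then show False using no_monochromatic_pair[of P 0 x Q] PQ mono sub by auto
  next
    case 2
    then have "c {q, p} = 1" if "p \<in> P" "q \<in> Q" for p q
      using mono[OF that] by (simp add: insert_commute)
    moreover have "Q \<inter> P = {}" "Q \<subseteq> nim_nbrs n H c 1 z" "z \<notin> P"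
      using PQ(1-3) by blast+
    ultimately show False using no_monochromatic_pair[of Q 1 z P] PQ(4,5) sub by blast
  qed
qed

text \<open>If \<open>w'\<close> has few neighbours of colour \<open>j\<close>, take
  \<open>p = w'\<close>. Otherwise take \<open>p = z\<close>: if some \<open>x\<close> had many
  NIM-neighbours of colour \<open>i\<close> that \<open>z\<close> sees in colour \<open>j\<close>, a
  monochromatic bipartite graph between them and the \<open>j\<close>-neighbourhood of
  \<open>w'\<close> would contradict the NIM-edges at \<open>x\<close> (colour \<open>i\<close>) or
  the NIM-edge \<open>{z, w'}\<close> (colour \<open>j\<close>).\<close>

lemma few_nim_nbrs:
  assumes z: "{z, w'} \<in> nim_edges n H c" "c {z, w'} = j" and ij: "i < 2" "j < 2" "i \<noteq> j"
  shows "\<exists>p<n. \<forall>x. card (nim_nbrs n H c i x - colour_nbrs n c i p) \<le> bip_ramsey_bound h"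
proof -
  have zw: "z < n" "w' < n" "z \<noteq> w'" using nim_edgeD[OF z(1)] by auto
  \<comment> \<open>The vertex \<open>p\<close> lies in neither of its colour neighbourhoods; the
    strict bound assumed in \<open>suff\<close> absorbs this one extra vertex.\<close>
  have rest: "nim_nbrs n H c i x - colour_nbrs n c i p
      \<subseteq> insert p (nim_nbrs n H c i x \<inter> colour_nbrs n c j p)" if "p < n" for x p
  proof
    fix u assume u: "u \<in> nim_nbrs n H c i x - colour_nbrs n c i p"
    then have "u < n" using nim_nbrs_subset by (fastforce simp: colour_nbrs_def)
    then show "u \<in> insert p (nim_nbrs n H c i x \<inter> colour_nbrs n c j p)"
      using u that ij colour_less[of p u] by (auto simp: colour_nbrs_def)
  qed
  have suff: ?thesis
    if p: "p < n" "\<And>x. card (nim_nbrs n H c i x \<inter> colour_nbrs n c j p) < bip_ramsey_bound h" for p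
  proof (intro exI conjI allI)
    show "p < n" by fact
    fix x
    have "card (nim_nbrs n H c i x - colour_nbrs n c i p)
        \<le> card (insert p (nim_nbrs n H c i x \<inter> colour_nbrs n c j p))"
      by (intro card_mono rest p(1)) (simp add: finite_nim_nbrs)
    also have "\<dots> \<le> Suc (card (nim_nbrs n H c i x \<inter> colour_nbrs n c j p))"
      by (simp add: card_insert_if finite_nim_nbrs)
    also have "\<dots> \<le> bip_ramsey_bound h" using p(2) by (simp add: Suc_le_eq)
    finally show "card (nim_nbrs n H c i x - colour_nbrs n c i p) \<le> bip_ramsey_bound h" .
  qed
  show ?thesis
  proof (cases "card (colour_nbrs n c j w') < bip_ramsey_bound h")
    case True
    have "card (nim_nbrs n H c i x \<inter> colour_nbrs n c j w') < bip_ramsey_bound h" for x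
      using True card_mono[OF finite_colour_nbrs, of "nim_nbrs n H c i x \<inter> colour_nbrs n c j w'"]
      by (meson Int_lower2 le_less_trans)
    then show ?thesis using suff zw by blast
  next
    case False
    then have D: "bip_ramsey_bound h \<le> card (colour_nbrs n c j w')" by simp
    have "card (nim_nbrs n H c i x \<inter> colour_nbrs n c j z) < bip_ramsey_bound h" for x
    proof (rule ccontr)
      define A where "A = nim_nbrs n H c i x \<inter> colour_nbrs n c j z"
      assume "\<not> ?thesis"
      then have A: "bip_ramsey_bound h \<le> card A" by (simp add: A_def)
      have "finite A" by (simp add: A_def finite_nim_nbrs)
      obtain P Q k where PQ: "P \<subseteq> A - {x, z, w'}" "Q \<subseteq> colour_nbrs n c j w' - {x, z, w'}"
        "P \<inter> Q = {}" "h \<le> card P" "h \<le> card Q" "k < 2"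
        and mono: "\<And>p q. p \<in> P \<Longrightarrow> q \<in> Q \<Longrightarrow> c {p, q} = k"
        by (rule monochromatic_bipartite[OF A D \<open>finite A\<close> finite_colour_nbrs, of "{x, z, w'}" c])
          (auto simp: card_insert_if A_def colour_nbrs_def intro!: colour_less)
      have sub: "P \<subseteq> {..<n}" "Q \<subseteq> {..<n}"
        using PQ(1,2) by (auto simp: A_def colour_nbrs_def)
      consider "k = i" | "k = j" using PQ(6) ij by linarith
      then show False
      proof cases
        case 1
        then show False using no_monochromatic_pair[of P i x Q] PQ mono sub by (auto simp: A_def)
      next
        case 2
        then have "{z, w'} \<notin> nim_edges n H c"
          using PQ mono z(2) sub
          by (intro not_nim_edge[of P Q z w' j]) (auto simp: A_def colour_nbrs_def)
        then show False using z(1) by simp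
      qed
    qed
    then show ?thesis using suff zw by blast
  qed
qed

text \<open>Colour \<open>j\<close> of bounded NIM-degree and the edges of colour \<open>i\<close>
  not inside \<open>S\<close> contribute one Ramsey bound per vertex each; the edges inside
  \<open>S\<close> contribute the extremal number of \<open>H - r\<close>. The summand
  \<open>h\<close> covers the case of a small \<open>S\<close>.\<close>

lemma card_nim_edges_bicoloured:
  assumes r: "r \<in> verts H" and e: "e \<in> edges H" "r \<notin> e"
    and two: "e0 \<in> nim_edges n H c" "e1 \<in> nim_edges n H c" "c e0 \<noteq> c e1"
  shows "card (nim_edges n H c) \<le> ex_num n (delete_vertex H r) + (2 * bip_ramsey_bound h + h) * n"
proof -
  obtain j where j: "j < 2" "\<And>x. card (nim_nbrs n H c j x) < bip_ramsey_bound h"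
    using degree_dichotomy by metis
  define i where "i = 1 - j"
  have i: "i < 2" "i \<noteq> j" unfolding i_def using j(1) by presburger+
  have "c e0 < 2" "c e1 < 2"
    using colouring two by (auto simp: edge_colouring_def nim_edges_def)
  then obtain e' where e': "e' \<in> nim_edges n H c" "c e' = j"
    using two j(1) by (metis less_2_cases)
  then obtain z w' where "e' = {z, w'}" by (auto simp: nim_edges_def elim: nsets2_E)
  then obtain p where p: "p < n"
    "\<And>x. card (nim_nbrs n H c i x - colour_nbrs n c i p) \<le> bip_ramsey_bound h"
    using few_nim_nbrs[of z w' j i] e' i j(1) by metis
  define S where "S = colour_nbrs n c i p"
  have Nj: "card {e \<in> nim_edges n H c. c e = j} \<le> n * bip_ramsey_bound h"
    using j(2) less_imp_le by (intro card_nim_edges_colour_le) blast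
  have "card {e \<in> nim_edges n H c. c e = i}
      \<le> ex_num n (delete_vertex H r) + n * (bip_ramsey_bound h + h)"
  \<comment> \<open>If \<open>S\<close> has fewer than \<open>h\<close> vertices, there may be no
    room for the isolated vertices of \<open>H - r\<close>, but then all NIM-degrees of colour
    \<open>i\<close> are bounded as well.\<close>
  proof (cases "h \<le> card S")
    case True
    have "card {e \<in> nim_edges n H c. c e = i \<and> e \<subseteq> S} \<le> ex_num n (delete_vertex H r)"
      using card_nim_edges_inside_le[OF simple r e p(1) S_def True] .
    moreover have "card {e \<in> nim_edges n H c. c e = i \<and> \<not> e \<subseteq> S} \<le> n * bip_ramsey_bound h"
      using p(2) by (intro card_nim_edges_le) (simp add: S_def)
    moreover have eq: "{e \<in> nim_edges n H c. c e = i}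
        = {e \<in> nim_edges n H c. c e = i \<and> e \<subseteq> S} \<union> {e \<in> nim_edges n H c. c e = i \<and> \<not> e \<subseteq> S}"
      by auto
    have "card {e \<in> nim_edges n H c. c e = i}
        \<le> card {e \<in> nim_edges n H c. c e = i \<and> e \<subseteq> S}
          + card {e \<in> nim_edges n H c. c e = i \<and> \<not> e \<subseteq> S}"
      by (subst eq) (rule card_Un_le)
    ultimately show ?thesis by (simp add: algebra_simps)
  next
    case False
    have "card (nim_nbrs n H c i x) \<le> bip_ramsey_bound h + h" for x
    proof -
      have "card (nim_nbrs n H c i x) \<le> card ((nim_nbrs n H c i x - S) \<union> S)"
        by (intro card_mono) (auto simp: finite_nim_nbrs finite_colour_nbrs S_def)
      also have "\<dots> \<le> card (nim_nbrs n H c i x - S) + card S" by (rule card_Un_le)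
      also have "\<dots> \<le> bip_ramsey_bound h + h" using p(2)[of x] False by (simp add: S_def)
      finally show ?thesis .
    qed
    then have "card {e \<in> nim_edges n H c. c e = i} \<le> n * (bip_ramsey_bound h + h)"
      by (intro card_nim_edges_colour_le) blast
    then show ?thesis by simp
  qed
  then show ?thesis
    using Nj card_nim_edges_split[OF colouring i(1) j(1) i(2), of H] by (simp add: algebra_simps)
qed

end

text \<open>Here \<open>H\<close> is a star with centre \<open>r\<close>, possibly with isolated
  vertices. More than \<open>h\<close> NIM-neighbours of one colour at \<open>x\<close> would yield
  a monochromatic copy centred at \<open>x\<close> through one of these edges. The factor 2 counts
  the colours.\<close>

lemma card_nim_edges_star:
  assumes H: "simple_graph H" "edges H \<noteq> {}" and r: "r \<in> verts H" "\<And>e. e \<in> edges H \<Longrightarrow> r \<in> e"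
    and c: "edge_colouring 2 n c"
  shows "card (nim_edges n H c) \<le> 2 * card (verts H) * n"
proof -
  obtain d where d: "d \<in> edges H" using H(2) by auto
  obtain w where w: "d = {r, w}" "w \<noteq> r"
    using r(2)[OF d] simple_graph_edge(2)[OF H(1) d] by (auto simp: card_2_iff)
  have wH: "w \<in> verts H" using simple_graph_edge(1)[OF H(1) d] w by auto
  have star: "\<exists>a\<in>{r}. \<exists>b\<in>verts H - {r}. e = {a, b}" if "e \<in> edges H" for e
    using r(2)[OF that] simple_graph_edge(1,2)[OF H(1) that] by (auto simp: card_2_iff)
  have fin: "finite (verts H)" using H(1) by (simp add: simple_graph_def)
  have "card (nim_nbrs n H c i x) \<le> card (verts H)" for i x
  proof (rule ccontr)
    assume "\<not> ?thesis"
    then have big: "card (verts H) < card (nim_nbrs n H c i x)" by simp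
    then obtain u where u: "u \<in> nim_nbrs n H c i x" by fastforce
    have sub: "nim_nbrs n H c i x \<subseteq> {..<n}" "x \<notin> nim_nbrs n H c i x"
      "\<And>p. p \<in> nim_nbrs n H c i x \<Longrightarrow> c {x, p} = i"
      using nim_nbrs_subset[of n H c i x] by (auto simp: colour_nbrs_def)
    have "card (verts H - {r} - {w}) \<le> card (verts H)" using fin by (intro card_mono) auto
    then have "card (verts H - {r} - {w}) \<le> card (nim_nbrs n H c i x - {u})"
      using big u by (simp add: card_Diff_singleton finite_nim_nbrs)
    then have "{x, u} \<notin> nim_edges n H c"
      \<comment> \<open>The part \<open>{r}\<close> has no vertex besides \<open>r\<close>, so the
        empty set serves as \<open>Q\<close>.\<close>
      using not_nim_edgeI[of H "{r}" "verts H - {r}" r w "nim_nbrs n H c i x - {u}" n "{}" x u c i]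
        H(1) r(1) star d w wH sub u by auto
    then show False using u by (simp add: nim_nbrs_def)
  qed
  then have le: "card {e \<in> nim_edges n H c. c e = i} \<le> n * card (verts H)" for i
    by (intro card_nim_edges_colour_le)
  have "card (nim_edges n H c) \<le> n * card (verts H) + n * card (verts H)"
    unfolding card_nim_edges_split[OF c, of 0 1 H, simplified] by (intro add_mono le)
  then show ?thesis by (simp add: algebra_simps)
qed


section \<open>Extremal colourings\<close>

text \<open>Colour a maximum \<open>H\<close>-free graph, moved to the vertex set
  \<open>{..<n}\<close>, with 0 and all else with 1. A monochromatic copy through an edge of colour
  0 would lie inside that graph.\<close>

lemma colouring_of_maximum_free_graph:
  assumes H: "simple_graph H" and pos: "ex_num n H > 0"
  obtains c where "edge_colouring 2 n c" "ex_num n H \<le> card (nim_edges n H c)"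
proof -
  obtain G where G: "maximum_free_graph n H G" using ex_num_pos_maximum[OF pos] .
  then have G': "simple_graph G" "card (verts G) = n" "free_of H G" "card (edges G) = ex_num n H"
    by (auto simp: maximum_free_graph_def free_graphs_def)
  have fin: "finite (verts G)" using G'(1) by (simp add: simple_graph_def)
  obtain \<phi> where \<phi>: "bij_betw \<phi> (verts G) {..<n}"
    using finite_same_card_bij[OF fin, of "{..<n}"] G'(2) by auto
  define \<psi> where "\<psi> = inv_into (verts G) \<phi>"
  have \<psi>: "bij_betw \<psi> {..<n} (verts G)" unfolding \<psi>_def by (rule bij_betw_inv_into[OF \<phi>])
  define E where "E = (`) \<phi> ` edges G"
  have \<psi>E: "\<psi> ` e \<in> edges G" if e: "e \<in> E" for e
  proof -
    obtain d where d: "d \<in> edges G" "e = \<phi> ` d" using e by (auto simp: E_def)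
    have "d \<subseteq> verts G" using simple_graph_edge(1)[OF G'(1) d(1)] .
    then have "\<psi> ` e = d"
      unfolding d(2) \<psi>_def using \<phi> by (intro inv_into_image_cancel) (auto simp: bij_betw_def)
    then show ?thesis using d(1) by simp
  qed
  define c where "c = (\<lambda>e. if e \<in> E then 0 else 1 :: nat)"
  have "E \<subseteq> nim_edges n H c"
  proof
    fix e assume e: "e \<in> E"
    then obtain d where d: "d \<in> edges G" "e = \<phi> ` d" by (auto simp: E_def)
    have "inj_on \<phi> d" "\<phi> ` d \<subseteq> {..<n}"
      using \<phi> simple_graph_edge(1)[OF G'(1) d(1)] by (auto simp: bij_betw_def inj_on_subset)
    then have "e \<in> nsets {..<n} 2"
      using simple_graph_edge[OF G'(1) d(1)] d(2) by (simp add: nsets_def card_image)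
    moreover have False
      if F: "copy_in H (complete_graph n) F" "monochromatic c F" "e \<in> edges F" for F
    proof -
      obtain f where f: "embedding H (complete_graph n) f" "F = (f ` verts H, (`) f ` edges H)"
        using F(1) copy_in_iff[OF H] by blast
      obtain i where "\<And>d. d \<in> edges F \<Longrightarrow> c d = i" using F(2) by (auto simp: monochromatic_def)
      then have "edges F \<subseteq> E" using F(3) e by (metis c_def subsetI zero_neq_one)
      then have "(\<psi> \<circ> f) ` d \<in> edges G" if "d \<in> edges H" for d
        unfolding image_comp[symmetric] using f(2) that by (intro \<psi>E) auto
      moreover have "inj_on (\<psi> \<circ> f) (verts H)" "(\<psi> \<circ> f) ` verts H \<subseteq> verts G"
        using f(1) \<psi> by (auto simp: embedding_def bij_betw_def intro!: comp_inj_on intro: inj_on_subset)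
      ultimately have "embedding H G (\<psi> \<circ> f)" by (auto simp: embedding_def)
      then show False using G'(3) unfolding free_of_iff[OF H] by blast
    qed
    ultimately show "e \<in> nim_edges n H c" by (auto simp: nim_edges_def)
  qed
  then have "card E \<le> card (nim_edges n H c)" by (intro card_mono finite_nim_edges)
  moreover have "card E = ex_num n H"
  proof -
    have "inj_on ((`) \<phi>) (edges G)"
      by (rule inj_on_subset[OF inj_on_image_Pow[of \<phi> "verts G"]])
        (use \<phi> simple_graph_edge(1)[OF G'(1)] in \<open>auto simp: bij_betw_def\<close>)
    then show ?thesis using G'(4) by (simp add: E_def card_image)
  qed
  moreover have "edge_colouring 2 n c" by (auto simp: edge_colouring_def c_def)
  ultimately show ?thesis using that by simp
qed

text \<open>If all edges contained \<open>r\<close>, the linear bound for stars would contradict the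
  many NIM-edges of the colouring by a maximum \<open>H\<close>-free graph.\<close>

lemma edge_avoiding_vertex:
  assumes H: "simple_graph H" and n: "card (verts H) \<le> n" and r: "r \<in> verts H"
    and ex: "2 * card (verts H) * n < ex_num n H"
  obtains e where "e \<in> edges H" "r \<notin> e"
proof -
  have "edges H \<noteq> {}" using ex_num_edgeless[OF H _ n] ex by auto
  obtain c where "edge_colouring 2 n c" "ex_num n H \<le> card (nim_edges n H c)"
    using colouring_of_maximum_free_graph[OF H, of n] ex by auto
  then have "\<exists>e \<in> edges H. r \<notin> e"
    using card_nim_edges_star[OF H \<open>edges H \<noteq> {}\<close> r] ex by fastforce
  then show ?thesis using that by blast
qed

text \<open>With \<open>t = 2 ^ h \<ge> 8\<close> the left side is at most
  \<open>8 * t ^ 3 \<le> t ^ 4 = 2 ^ (4 * h)\<close>, and \<open>4 * h \<le> 2 * h ^ 2\<close>. Thus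
  the gap in weak reducibility exceeds the linear error term.\<close>

lemma bip_ramsey_bound_le:
  assumes "3 \<le> h"
  shows "2 * bip_ramsey_bound h + h \<le> 2 ^ (2 * h ^ 2)"
proof -
  have h: "h < 2 ^ h" by (rule less_exp)
  have "(2::nat) ^ 3 \<le> 2 ^ h" using assms by (intro power_increasing) auto
  then have 8: "8 \<le> (2::nat) ^ h" by simp
  define t where "t = (2::nat) ^ h"
  have t: "h \<le> t" "8 \<le> t" using h 8 by (auto simp: t_def)
  have "2 * bip_ramsey_bound h + h = 2 * (h * t ^ 2) + 5 * h + 6"
    by (simp add: bip_ramsey_bound_def t_def power_mult[symmetric] mult.commute)
  also have "\<dots> \<le> 2 * (t * t ^ 2) + 5 * t + 6"
    using t(1) by (intro add_mono mult_le_mono) auto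
  also have "\<dots> \<le> 2 * (t * t ^ 2) + 6 * (t * t ^ 2)"
  proof -
    have "6 \<le> t" using t by simp
    have "t * 1 \<le> t * t ^ 2" using t by (intro mult_le_mono) auto
    have "t * 8 \<le> t * t ^ 2" using t by (intro mult_le_mono) (auto simp: power2_eq_square intro: order_trans[of 8 t])
    then show ?thesis using \<open>6 \<le> t\<close> by linarith
  qed
  also have "\<dots> = 8 * t ^ 3" by (simp add: power3_eq_cube power2_eq_square)
  also have "\<dots> \<le> t * t ^ 3" using t by simp
  also have "\<dots> = 2 ^ (h * 4)" by (simp add: t_def power_mult power4_eq_xxxx power3_eq_cube)
  also have "\<dots> \<le> 2 ^ (2 * h ^ 2)"
    using assms by (intro power_increasing) (auto simp: power2_eq_square)
  finally show ?thesis .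
qed

lemma nim_edges_monochromatic:
  assumes H: "simple_graph H" "bipartite H" and n: "card (verts H) \<le> n" and r: "r \<in> verts H"
    and e: "e \<in> edges H" "r \<notin> e"
    and ex: "ex_num n (delete_vertex H r) + 2 ^ (2 * card (verts H) ^ 2) * n < ex_num n H"
    and c: "edge_colouring 2 n c" "ex_num n H \<le> card (nim_edges n H c)"
  obtains i where "i < 2" "\<And>e. e \<in> nim_edges n H c \<Longrightarrow> c e = i"
proof -
  obtain X Y where XY: "X \<union> Y = verts H" "X \<inter> Y = {}"
    "\<And>e. e \<in> edges H \<Longrightarrow> \<exists>a\<in>X. \<exists>b\<in>Y. e = {a, b}"
    using H(2) unfolding bipartite_def by metis
  obtain v w where vw: "v \<in> X" "w \<in> Y" "{v, w} \<in> edges H" using XY(3)[OF e(1)] e(1) by auto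
  interpret nim_colouring H n c X Y v w
    using H(1) XY vw c(1) by unfold_locales
  have fin: "finite (verts H)" using H(1) by (simp add: simple_graph_def)
  \<comment> \<open>The vertex \<open>r\<close> and the two ends of \<open>e\<close> provide the
    three vertices that \<open>bip_ramsey_bound_le\<close> asks for.\<close>
  have "card (insert r e) = 3" "insert r e \<subseteq> verts H"
    using simple_graph_edge[OF H(1) e(1)] e(2) r by auto
  then have "3 \<le> h" using card_mono[OF fin] by metis
  then have "(2 * bip_ramsey_bound h + h) * n \<le> 2 ^ (2 * h ^ 2) * n"
    by (intro mult_le_mono1 bip_ramsey_bound_le)
  then have less: "ex_num n (delete_vertex H r) + (2 * bip_ramsey_bound h + h) * n
      < card (nim_edges n H c)"
    using ex c(2) by linarith
  have eq: "c e0 = c e1" if "e0 \<in> nim_edges n H c" "e1 \<in> nim_edges n H c" for e0 e1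
    using card_nim_edges_bicoloured[OF r e that] less by (meson not_less)
  have "nim_edges n H c \<noteq> {}" using less by auto
  then obtain e0 where e0: "e0 \<in> nim_edges n H c" by auto
  then have "c e0 < 2" using c(1) by (auto simp: edge_colouring_def nim_edges_def)
  then show ?thesis using eq[OF _ e0] by (rule that)
qed

text \<open>A copy of \<open>H\<close> made of NIM-edges would be monochromatic, contradicting that
  its edges are NIM-edges.\<close>

lemma card_nim_edges_monochromatic_le:
  assumes H: "simple_graph H" "edges H \<noteq> {}"
    and i: "\<And>e. e \<in> nim_edges n H c \<Longrightarrow> c e = i"
  shows "({..<n}, nim_edges n H c) \<in> free_graphs n H" "card (nim_edges n H c) \<le> ex_num n H"
proof -
  have "\<nexists>f. embedding H ({..<n}, nim_edges n H c) f"
  proof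
    assume "\<exists>f. embedding H ({..<n}, nim_edges n H c) f"
    then obtain f where f: "inj_on f (verts H)" "f ` verts H \<subseteq> {..<n}"
      "\<And>d. d \<in> edges H \<Longrightarrow> f ` d \<in> nim_edges n H c"
      by (auto simp: embedding_def)
    obtain d where "d \<in> edges H" using H(2) by auto
    then show False using nim_edge_not_in_copy[OF H(1) f(1,2), of c i d] f(3) i by blast
  qed
  then show free: "({..<n}, nim_edges n H c) \<in> free_graphs n H"
    using free_of_iff[OF H(1)] by (auto simp: free_graphs_def simple_graph_def nim_edges_def)
  show "card (nim_edges n H c) \<le> ex_num n H" using ex_num_upper[OF free] by simp
qed

text \<open>A further edge of the colour \<open>i\<close> would complete a monochromatic copy of \<open>H\<close>, and as \<open>H\<close> has a
  second edge, that copy contains a NIM-edge.\<close>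

lemma maximum_free_colour_class:
  assumes H: "simple_graph H" "d1 \<in> edges H" "d2 \<in> edges H" "d1 \<noteq> d2"
    and i: "\<And>e. e \<in> nim_edges n H c \<Longrightarrow> c e = i"
    and card: "card (nim_edges n H c) = ex_num n H"
  shows "maximum_free_graph n H (colour_class n c i)"
proof -
  have "nim_edges n H c = {e \<in> nsets {..<n} 2. c e = i}"
  proof (rule ccontr)
    assume "\<not> ?thesis"
    then obtain e where e: "e \<in> nsets {..<n} 2" "c e = i" "e \<notin> nim_edges n H c"
      using i by (auto simp: nim_edges_def)
    define G where "G = ({..<n}, insert e (nim_edges n H c))"
    have "card (edges G) = Suc (ex_num n H)"
      using e(3) card by (simp add: G_def finite_nim_edges)
    then have "G \<notin> free_graphs n H" using ex_num_upper[of G n H] by auto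
    moreover have "simple_graph G" "card (verts G) = n"
      using e(1) by (auto simp: G_def simple_graph_def nim_edges_def)
    ultimately obtain f where "embedding H G f"
      using free_of_iff[OF H(1), of G] by (auto simp: free_graphs_def)
    then have f: "inj_on f (verts H)" "f ` verts H \<subseteq> {..<n}"
      "\<And>d. d \<in> edges H \<Longrightarrow> f ` d \<in> insert e (nim_edges n H c)"
      by (auto simp: embedding_def G_def)
    have "f ` d1 \<noteq> f ` d2"
      using inj_on_image_eq_iff[OF f(1) simple_graph_edge(1)[OF H(1,2)]
          simple_graph_edge(1)[OF H(1,3)]] H(4) by simp
    then obtain d where d: "d \<in> edges H" "f ` d \<in> nim_edges n H c"
      using f(3) H(2,3) by (metis insertE)
    have "c (f ` d) = i" if "d \<in> edges H" for d using f(3)[OF that] i e(2) by auto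
    then show False using nim_edge_not_in_copy[OF H(1) f(1,2), of c i d] d by blast
  qed
  then have "colour_class n c i = ({..<n}, nim_edges n H c)" by (simp add: colour_class_def)
  moreover have "edges H \<noteq> {}" using H(2) by blast
  ultimately show ?thesis
    using card_nim_edges_monochromatic_le(1)[of H n c i] H(1) i card
    by (simp add: maximum_free_graph_def)
qed

lemma isomorphic_refl: "isomorphic G G"
  by (auto simp: isomorphic_def intro!: exI[of _ id])

theorem theorem1p11:
  fixes H :: "'a graph"
  assumes "simple_graph H"
    and "bipartite H"
    and "weakly_reducible H"
  shows "\<exists>N. \<forall>n \<ge> N.
    nim 2 n H = ex_num n H \<and>
    (\<forall>c. edge_colouring 2 n c \<and> card (nim_edges n H c) = nim 2 n H \<longrightarrow>
      (\<exists>i < 2. \<exists>G. maximum_free_graph n H G \<and> isomorphic (colour_class n c i) G))"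
proof -
  let ?h = "card (verts H)"
  obtain n0 r where r: "r \<in> verts H" and red: "\<And>n. n \<ge> n0 \<Longrightarrow>
      real (ex_num n (delete_vertex H r)) < real (ex_num n H) - 2 ^ (2 * ?h ^ 2) * real n"
    using assms(3) unfolding weakly_reducible_def by blast
  show ?thesis
  \<comment> \<open>Beyond \<open>n0\<close> the gap of weak reducibility holds; beyond
    \<open>?h\<close> an edgeless \<open>H\<close> would have extremal number 0.\<close>
  proof (intro exI[of _ "max n0 ?h"] allI impI)
    fix n assume n: "max n0 ?h \<le> n"
    have "real (ex_num n (delete_vertex H r) + 2 ^ (2 * ?h ^ 2) * n) < real (ex_num n H)"
      using red[of n] n by simp
    then have ex: "ex_num n (delete_vertex H r) + 2 ^ (2 * ?h ^ 2) * n < ex_num n H"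
      by (simp only: of_nat_less_iff)
    have hn: "?h \<le> n" using n by simp
    have "2 * ?h \<le> 2 * ?h ^ 2" by (simp add: power2_eq_square)
    also have "\<dots> \<le> 2 ^ (2 * ?h ^ 2)" using less_exp less_imp_le by blast
    finally have "2 * ?h * n \<le> 2 ^ (2 * ?h ^ 2) * n" by (rule mult_le_mono1)
    then have star: "2 * ?h * n < ex_num n H" using ex by linarith
    obtain e where e: "e \<in> edges H" "r \<notin> e"
      using edge_avoiding_vertex[OF assms(1) hn r star] .
    \<comment> \<open>An edge avoiding an end \<open>u\<close> of \<open>e\<close> is a second edge
      of \<open>H\<close>, as \<open>maximum_free_colour_class\<close> requires.\<close>
    obtain u where u: "u \<in> e" using simple_graph_edge(2)[OF assms(1) e(1)] by fastforce
    then have "u \<in> verts H" using simple_graph_edge(1)[OF assms(1) e(1)] by blast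
    then obtain e' where e': "e' \<in> edges H" "u \<notin> e'"
      using edge_avoiding_vertex[OF assms(1) hn _ star] by blast
    have mono: "\<exists>i<2. \<forall>d \<in> nim_edges n H c. c d = i"
      if "edge_colouring 2 n c" "ex_num n H \<le> card (nim_edges n H c)" for c
      using nim_edges_monochromatic[OF assms(1,2) hn r e ex that] by metis
    \<comment> \<open>A colouring with more NIM-edges than the extremal number would have them all
      in one colour, where they form an \<open>H\<close>-free graph.\<close>
    have le: "card (nim_edges n H c) \<le> ex_num n H" if c: "edge_colouring 2 n c" for c
    proof (rule ccontr)
      assume "\<not> ?thesis"
      then show False
        using mono[OF c] card_nim_edges_monochromatic_le(2)[OF assms(1), of n c] e(1) by fastforce
    qed
    obtain c where c: "edge_colouring 2 n c" "ex_num n H \<le> card (nim_edges n H c)"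
      using colouring_of_maximum_free_graph[OF assms(1), of n] star by auto
    have "nim 2 n H = ex_num n H"
      unfolding nim_def
    proof (rule Max_eqI)
      show "finite {card (nim_edges n H c) |c. edge_colouring 2 n c}"
        by (rule finite_subset[of _ "{..ex_num n H}"]) (use le in auto)
      show "ex_num n H \<in> {card (nim_edges n H c) |c. edge_colouring 2 n c}"
        using c le[OF c(1)] by force
    qed (use le in auto)
    moreover have "\<exists>i < 2. \<exists>G. maximum_free_graph n H G \<and> isomorphic (colour_class n c i) G"
      if c: "edge_colouring 2 n c" "card (nim_edges n H c) = ex_num n H" for c
    proof -
      obtain i where "i < 2" "\<And>d. d \<in> nim_edges n H c \<Longrightarrow> c d = i"
        using mono[OF c(1)] c(2) by auto
      moreover have "e \<noteq> e'" using u e'(2) by blast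
      \<comment> \<open>The colour class is itself a maximum \<open>H\<close>-free graph, so the
        identity serves as isomorphism.\<close>
      ultimately show ?thesis
        using maximum_free_colour_class[OF assms(1) e(1) e'(1) _ _ c(2)] isomorphic_refl by blast
    qed
    ultimately show "nim 2 n H = ex_num n H \<and>
      (\<forall>c. edge_colouring 2 n c \<and> card (nim_edges n H c) = nim 2 n H \<longrightarrow>
        (\<exists>i < 2. \<exists>G. maximum_free_graph n H G \<and> isomorphic (colour_class n c i) G))"
      by simp
  qed
qed

end
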